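(* Let $A,B\in\mathbb{Z}$ and let $\phi_{A,B}(z):=\operatorname{Li}_2(z)+4\pi^2A+2\pi i B\log(z)$. Then $\phi_{A,B}$ has no zeros in $\mathbb{C}$ unless (i) $B=0$ and $A\geqslant 0$, or (ii) $-|B|/2<A\leqslant |B|/2$. If (i) or (ii) holds, then $\phi_{A,B}$ has exactly one zero, and this zero is simple.
   Context: $\log$ denotes the principal branch of the logarithm, with $-\pi<\arg z\leqslant\pi$ and branch cut $(-\infty,0]$. $\operatorname{Li}_2$ denotes the principal branch of the dilogarithm: $\operatorname{Li}_2(z)=\sum_{n\geqslant1}z^n/n^2$ for $|z|\leqslant1$, analytically continued to $\mathbb{C}\setminus[1,\infty)$ by $\operatorname{Li}_2(z)=-\int_0^z\log(1-u)\,\frac{du}{u}$; for $x\in[1,\infty)$, $\operatorname{Li}_2(x)$ is defined as $\lim_{y\to0^-}\operatorname{Li}_2(x+iy)$. With these conventions $\phi_{A,B}$ is a single-valued function on $\mathbb{C}$ (on $\mathbb{C}\setminus\{0\}$ when $B\neq0$), holomorphic away from $(-\infty,0]\cup[1,\infty)$ (away from $[1,\infty)$ when $B=0$). Every branch of the analytically continued dilogarithm has the form $\phi_{A,B}$ for some integers $A,B$. *)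

theory Defs
  imports "HOL-Complex_Analysis.Complex_Analysis"
begin

text \<open>
  \<^const>\<open>Ln\<close> is the principal branch of the logarithm, with imaginary part in
  \<open>(-\<pi>, \<pi>]\<close>. The segment from \<open>0\<close> to \<open>z\<close> avoids \<open>[1,\<infinity>)\<close> whenever \<open>z\<close> does; the value of the
  integrand at the single point \<open>u = 0\<close> is irrelevant.
\<close>

definition dilog_integral :: "complex \<Rightarrow> complex" where
  "dilog_integral z = - contour_integral (linepath 0 z) (\<lambda>u. Ln (1 - u) / u)"

text \<open>On the cut \<open>[1,\<infinity>)\<close> the value is the limit from the lower half-plane.\<close>

definition Li2 :: "complex \<Rightarrow> complex" where
  "Li2 z = (if z \<in> complex_of_real ` {1..}
            then Lim (at_left 0) (\<lambda>y. dilog_integral (Complex (Re z) y))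
            else dilog_integral z)"

definition \<phi> :: "int \<Rightarrow> int \<Rightarrow> complex \<Rightarrow> complex" where
  "\<phi> A B z = Li2 z + 4 * (of_real pi)\<^sup>2 * of_int A + 2 * of_real pi * \<i> * of_int B * Ln z"

text \<open>
  For \<open>B \<noteq> 0\<close> the function is only defined away from \<open>0\<close>; this has to be said explicitly, since
  \<^term>\<open>Ln 0 = 0\<close> would make \<open>0\<close> a spurious zero when \<open>A = 0\<close>.
\<close>

definition \<phi>_domain :: "int \<Rightarrow> complex set" where
  "\<phi>_domain B = (if B = 0 then UNIV else - {0})"

definition \<phi>_zeros :: "int \<Rightarrow> int \<Rightarrow> complex set" where
  "\<phi>_zeros A B = {z \<in> \<phi>_domain B. \<phi> A B z = 0}"

text \<open>
  \<^const>\<open>zorder\<close> looks only at a punctured neighbourhood and is meaningful only at isolated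
  singularities, hence the requirement of analyticity at the point.
\<close>

definition simple_zero :: "(complex \<Rightarrow> complex) \<Rightarrow> complex \<Rightarrow> bool" where
  "simple_zero f z \<longleftrightarrow> f analytic_on {z} \<and> f z = 0 \<and> zorder f z = 1"

text \<open>The integral representation agrees with the defining power series.\<close>

lemma dilog_integral_has_field_derivative:
  assumes "z \<notin> complex_of_real ` {1..}"
  shows "(dilog_integral has_field_derivative (if z = 0 then 1 else - (Ln (1 - z) / z))) (at z)"
proof -
  define S where "S = - complex_of_real ` {1..}"
  define g where "g = (\<lambda>u::complex. if u = 0 then -1 else Ln (1 - u) / u)"
  have S_iff: "u \<in> S \<longleftrightarrow> Im u \<noteq> 0 \<or> Re u < 1" for u
    by (auto simp: S_def image_iff complex_eq_iff not_le)
  have clo: "closed (complex_of_real ` {1..})"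
  proof -
    have "complex_of_real ` {1..} = {u. Im u = 0} \<inter> {u. Re u \<ge> 1}"
      by (auto simp: image_iff complex_eq_iff)
    then show ?thesis
      by (auto intro!: closed_Int closed_halfspace_Im_eq closed_halfspace_Re_ge)
  qed
  then have opS: "open S" by (simp add: S_def open_Compl)
  have seg: "closed_segment 0 z \<subseteq> S" if "z \<in> S" for z
  proof
    fix w assume "w \<in> closed_segment 0 z"
    then obtain t where t: "0 \<le> t" "t \<le> 1" "w = of_real t * z"
      by (auto simp: in_segment scaleR_conv_of_real)
    have "t * Re z < 1" if "Re z < 1"
    proof (cases "Re z \<le> 0")
      case True
      then have "t * Re z \<le> 0" using t by (intro mult_nonneg_nonpos)
      then show ?thesis by linarith
    next
      case False
      then have "t * Re z \<le> 1 * Re z" using t by (intro mult_right_mono) auto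
      then show ?thesis using that by linarith
    qed
    with \<open>z \<in> S\<close> t show "w \<in> S" 
      by (cases "t = 0") (auto simp: S_iff)
  qed
  have star: "starlike S" 
    unfolding starlike_def using seg by (intro bexI[of _ 0]) (auto simp: S_iff)
  have nonpos: "1 - u \<notin> \<real>\<^sub>\<le>\<^sub>0" if "u \<in> S" for u
    using that by (auto simp: S_iff complex_nonpos_Reals_iff)
  have holg: "g holomorphic_on S"
  proof (rule no_isolated_singularity'[where K="{0}"])
    have "(\<lambda>u. Ln (1 - u) / u) holomorphic_on S - {0}"
      using nonpos by (auto intro!: holomorphic_intros)
    then show "g holomorphic_on S - {0}"
      by (rule holomorphic_transform) (auto simp: g_def)
    have "((\<lambda>u. Ln (1 - u)) has_field_derivative -1) (at 0)"
      by (auto intro!: derivative_eq_intros)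
    then have "(\<lambda>u. Ln (1 - u) / u) \<midarrow>0\<rightarrow> -1"
      by (simp add: has_field_derivative_iff)
    then have "g \<midarrow>0\<rightarrow> -1"
      by (rule Lim_transform_eventually) (auto simp: g_def eventually_at_filter)
    then show "(g \<longlongrightarrow> g z) (at z within S)" if "z \<in> {0}" for z
      using that by (auto simp: g_def intro: Lim_at_imp_Lim_at_within)
  qed (auto simp: opS)
  obtain f where f: "\<And>u. u \<in> S \<Longrightarrow> (f has_field_derivative g u) (at u)"
    using holomorphic_starlike_primitive[OF holomorphic_on_imp_continuous_on[OF holg] star opS, of "{}"]
      holg opS by (auto simp: holomorphic_on_open field_differentiable_def)
  have eq: "dilog_integral u = f 0 - f u" if u: "u \<in> S" for u
  proof (cases "u = 0")
    case False
    have "(g has_contour_integral (f u - f 0)) (linepath 0 u)"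
      using contour_integral_primitive[of S f g "linepath 0 u"] f seg[OF u] 
      by (auto intro: has_field_derivative_at_within)
    then have "((\<lambda>t. g (linepath 0 u t) * u) has_integral (f u - f 0)) {0..1}"
      by (simp add: has_contour_integral_linepath)
    then have "((\<lambda>t. Ln (1 - linepath 0 u t) / linepath 0 u t * u) has_integral (f u - f 0)) {0..1}"
      by (rule has_integral_spike_finite[of "{0}", rotated -1]) 
        (use False in \<open>auto simp: g_def linepath_def\<close>)
    then have "((\<lambda>u. Ln (1 - u) / u) has_contour_integral (f u - f 0)) (linepath 0 u)"
      by (simp add: has_contour_integral_linepath)
    then show ?thesis by (simp add: dilog_integral_def contour_integral_unique)
  qed (simp add: dilog_integral_def)
  have zS: "z \<in> S" using assms by (simp add: S_def)
  have "((\<lambda>u. f 0 - f u) has_field_derivative - g z) (at z)"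
    using f[OF zS] by (auto intro!: derivative_eq_intros)
  then have "(dilog_integral has_field_derivative - g z) (at z)"
    by (rule has_field_derivative_transform_within_open[OF _ opS zS]) (simp add: eq)
  then show ?thesis by (auto simp: g_def)
qed

lemma Li2_sums:
  assumes "norm z \<le> 1" "z \<noteq> 1"
  shows "(\<lambda>n. z ^ n / of_nat n ^ 2) sums Li2 z"
proof -
  define T where "T = (\<lambda>z::complex. \<Sum>n. 1 / of_nat n ^ 2 * z ^ n)"
  have bound: "norm (1 / of_nat n ^ 2 * w ^ n) \<le> 1 / real n ^ 2" if "norm w \<le> 1" for n and w :: complex
    using that by (simp add: norm_mult norm_divide norm_power power_le_one divide_right_mono)
  have summ: "summable (\<lambda>n. 1 / real n ^ 2)"
    using inverse_power_summable[of 2, where ?'a = real] by (simp add: inverse_eq_divide)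
  have T_sums: "(\<lambda>n. 1 / of_nat n ^ 2 * w ^ n) sums T w" if "norm w \<le> 1" for w
    unfolding T_def using summable_comparison_test'[OF summ bound[OF that]] by (simp add: summable_sums)
  have T_cont: "continuous_on (cball 0 1) T"
  proof -
    have "uniform_limit (cball 0 1) (\<lambda>N w. \<Sum>n<N. 1 / of_nat n ^ 2 * w ^ n) T sequentially"
      unfolding T_def by (rule Weierstrass_m_test[OF _ summ], rule bound) simp
    moreover have "continuous_on (cball 0 1) (\<lambda>w::complex. \<Sum>n<N. 1 / of_nat n ^ 2 * w ^ n)" for N
      by (intro continuous_on_sum continuous_on_mult continuous_on_power continuous_on_const continuous_on_id)
    ultimately show ?thesis
      by (intro uniform_limit_theorem[where F = sequentially]) (simp_all add: always_eventually)
  qed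
  have T_deriv: "(T has_field_derivative (if w = 0 then 1 else - (Ln (1 - w) / w))) (at w)"
    if w: "norm w < 1" for w
  proof -
    have "summable (\<lambda>n. 1 / of_nat n ^ 2 * (1::complex) ^ n)"
      using T_sums[of 1] by (simp add: sums_iff)
    then have "(T has_field_derivative (\<Sum>n. diffs (\<lambda>n. 1 / of_nat n ^ 2) n * w ^ n)) (at w)"
      unfolding T_def by (rule termdiffs_strong) (use w in auto)
    moreover have "diffs (\<lambda>n. 1 / of_nat n ^ 2) n = (1 / of_nat (Suc n) :: complex)" for n
      by (simp add: diffs_def power2_eq_square del: of_nat_Suc)
    moreover have "(\<Sum>n. 1 / of_nat (Suc n) * w ^ n) = (if w = 0 then 1 else - (Ln (1 - w) / w))"
    proof (cases "w = 0")
      case False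
      have "(\<lambda>n. - (w ^ n) / of_nat n) sums Ln (1 - w)"
        using Ln_series'[of "-w"] w by simp
      then have "(\<lambda>n. - (w ^ Suc n) / of_nat (Suc n)) sums Ln (1 - w)"
        by (subst sums_Suc_iff) simp
      then have "(\<lambda>n. - (w ^ Suc n) / of_nat (Suc n) * (- 1 / w)) sums (Ln (1 - w) * (- 1 / w))"
        by (rule sums_mult2)
      then show ?thesis using False by (simp add: sums_iff field_simps del: of_nat_Suc)
    qed (use powser_zero[of "\<lambda>n. 1 / of_nat (Suc n) :: complex"] in simp)
    ultimately show ?thesis by simp
  qed
  have off_cut: "w \<notin> complex_of_real ` {1..}" if "norm w \<le> 1" "w \<noteq> 1" for w
    using that by auto
  have "dilog_integral w - T w = dilog_integral 0 - T 0" if "w \<in> ball 0 1" for w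
  proof (rule has_field_derivative_zero_constant[of "ball 0 1", THEN exE])
    show "((\<lambda>w. dilog_integral w - T w) has_field_derivative 0) (at w within ball 0 1)"
      if "w \<in> ball 0 1" for w
    proof -
      have "w \<notin> complex_of_real ` {1..}" using that by (intro off_cut) auto
      from dilog_integral_has_field_derivative[OF this] T_deriv[of w] that
      have "((\<lambda>w. dilog_integral w - T w) has_field_derivative 0) (at w)"
        by (auto intro!: derivative_eq_intros)
      then show ?thesis by (rule has_field_derivative_at_within)
    qed
  qed (use that in auto)
  moreover have "T 0 = 0"
    unfolding T_def by (subst powser_zero) simp
  ultimately have inner: "dilog_integral w - T w = 0" if "w \<in> ball 0 1" for w
    using that by (simp add: dilog_integral_def)
  have scaled: "norm (of_real t * z) \<le> 1" "of_real t * z \<noteq> 1" if "t \<in> {0..1}" for t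
  proof -
    have *: "norm (of_real t * z) = t * norm z" using that by (simp add: norm_mult)
    show "norm (of_real t * z) \<le> 1" unfolding * using that assms by (simp add: mult_le_one)
    show "of_real t * z \<noteq> 1"
    proof (cases "t = 1")
      case False
      have "t * norm z \<le> t * 1" using that assms by (intro mult_left_mono) auto
      then have "t * norm z < 1" using that False by auto
      then show ?thesis using * by auto
    qed (use assms in simp)
  qed
  have "continuous_on {0..1} (\<lambda>t. dilog_integral (of_real t * z) - T (of_real t * z))"
  proof (intro continuous_on_diff)
    show "continuous_on {0..1} (\<lambda>t. dilog_integral (of_real t * z))"
    proof (rule continuous_on_compose2[of "- complex_of_real ` {1..}" dilog_integral])
      show "continuous_on (- complex_of_real ` {1..}) dilog_integral"
        using DERIV_isCont[OF dilog_integral_has_field_derivative]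
        by (intro continuous_at_imp_continuous_on) blast
      show "(\<lambda>t. of_real t * z) ` {0..1} \<subseteq> - complex_of_real ` {1..}"
        by (intro image_subsetI ComplI notI) (use off_cut[OF scaled] in blast)
    qed (intro continuous_intros)
    show "continuous_on {0..1} (\<lambda>t. T (of_real t * z))"
      by (rule continuous_on_compose2[OF T_cont]) (use scaled(1) in \<open>auto intro!: continuous_intros\<close>)
  qed
  moreover have "dilog_integral (of_real t * z) - T (of_real t * z) = 0" if "t \<in> {0..<1}" for t
  proof (rule inner)
    have "t * norm z \<le> t * 1" using that assms by (intro mult_left_mono) auto
    then show "of_real t * z \<in> ball 0 1" using that by (auto simp: norm_mult)
  qed
  ultimately have "dilog_integral (of_real 1 * z) - T (of_real 1 * z) = 0"
    using continuous_constant_on_closure[of "{0..<1::real}" "\<lambda>t. dilog_integral (of_real t * z) - T (of_real t * z)" 0 1]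
    by simp
  moreover have "Li2 z = dilog_integral z"
    using off_cut[OF assms] by (simp add: Li2_def)
  ultimately show ?thesis using T_sums[OF assms(1)] by simp
qed

end

theory Submission
  imports Defs
begin

text \<open>
  Put \<open>z = e^w\<close> with \<open>w\<close> in the strip \<open>0 < Im w < \<pi>\<close>. Then \<open>Li\<^sub>2(e^w) + 2 \<pi> \<i> B w\<close> has derivative
  \<open>- log (1 - e^w) + 2 \<pi> \<i> B\<close>, and \<open>- log (1 - e^w)\<close> has imaginary part in \<open>(0, \<pi>)\<close>. For \<open>B \<noteq> 0\<close>
  the imaginary part of the derivative therefore keeps one sign and stays away from \<open>0\<close>. As in the
  Noshiro-Warschawski theorem the function is injective, and it takes the real values lying strictly
  between its values at \<open>w = 0\<close> and \<open>w = \<i> \<pi>\<close>, which are \<open>\<pi>\<^sup>2/6\<close> and \<open>-\<pi>\<^sup>2/12 - 2 \<pi>\<^sup>2 B\<close>. Asking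
  for the value \<open>-4 \<pi>\<^sup>2 A\<close> gives \<open>0 \<le> A \<le> B/2\<close> when \<open>B > 0\<close> and \<open>B/2 < A < 0\<close> when \<open>B < 0\<close>. Zeros
  in the lower half-plane are conjugates of zeros for \<open>-B\<close> in the upper one, and there are none on the
  real line. For \<open>B = 0\<close> all zeros are real, where \<open>Li\<^sub>2\<close> is increasing on \<open>(-\<infinity>, 1)\<close>.
\<close>

section \<open>Real values of functions on a strip\<close>

text \<open>The real mean value theorem along the segment from \<open>u\<close> to \<open>v\<close>:
  since \<open>(v - u) * cnj (v - u)\<close> is real, differentiating
  \<open>Im (g * cnj (v - u))\<close> leaves \<open>Im g'\<close> times the squared length. This is
  a quantitative form of the Noshiro-Warschawski argument.\<close>

lemma Im_diff_mult_cnj_ge: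
  fixes g g' :: "complex \<Rightarrow> complex"
  assumes S: "convex S" "u \<in> S" "v \<in> S"
    and der: "\<And>w. w \<in> S \<Longrightarrow> (g has_field_derivative g' w) (at w)"
    and bound: "\<And>w. w \<in> S \<Longrightarrow> c \<le> Im (g' w)"
  shows "c * (norm (v - u))\<^sup>2 \<le> Im ((g v - g u) * cnj (v - u))"
proof -
  define p where "p t = u + of_real t * (v - u)" for t :: real
  define f where "f t = Im (g (p t) * cnj (v - u))" for t
  have inS: "p t \<in> S" if "t \<in> {0..1}" for t
  proof -
    have "(1 - t) *\<^sub>R u + t *\<^sub>R v \<in> S"
      using that S by (intro convexD_alt) auto
    then show ?thesis by (simp add: p_def scaleR_conv_of_real algebra_simps)
  qed
  have f': "(f has_real_derivative Im (g' (p t)) * (norm (v - u))\<^sup>2) (at t)" if "t \<in> {0..1}" for t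
  proof -
    have "(p has_vector_derivative (v - u)) (at t)"
      unfolding p_def by (auto intro!: derivative_eq_intros)
    then have "((g \<circ> p) has_vector_derivative (v - u) * g' (p t)) (at t)"
      by (rule field_vector_diff_chain_at) (rule der[OF inS[OF that]])
    then have "((\<lambda>t. g (p t) * cnj (v - u)) has_vector_derivative (v - u) * g' (p t) * cnj (v - u)) (at t)"
      unfolding o_def by (rule has_vector_derivative_mult_left)
    also have "(v - u) * g' (p t) * cnj (v - u) = of_real ((norm (v - u))\<^sup>2) * g' (p t)"
      by (simp only: complex_norm_square mult_ac)
    finally have "(f has_real_derivative Im (of_real ((norm (v - u))\<^sup>2) * g' (p t))) (at t)"
      unfolding f_def by (rule has_field_derivative_Im)
    moreover have "Im (of_real ((norm (v - u))\<^sup>2) * g' (p t)) = Im (g' (p t)) * (norm (v - u))\<^sup>2"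
      by (simp del: of_real_power)
    ultimately show ?thesis by (simp only:)
  qed
  obtain t where t: "t \<in> {0<..<1}" "f 1 - f 0 = Im (g' (p t)) * (norm (v - u))\<^sup>2"
  proof -
    have "\<exists>t>0. t < 1 \<and> f 1 - f 0 = (1 - 0) * (Im (g' (p t)) * (norm (v - u))\<^sup>2)"
      using f' by (intro MVT2) auto
    then show ?thesis using that by auto
  qed
  have "c * (norm (v - u))\<^sup>2 \<le> Im (g' (p t)) * (norm (v - u))\<^sup>2"
    using t inS by (intro mult_right_mono bound) auto
  also have "\<dots> = f 1 - f 0" by (simp only: t)
  also have "\<dots> = Im ((g v - g u) * cnj (v - u))"
    by (simp add: f_def p_def algebra_simps)
  finally show ?thesis .
qed

text \<open>Both signs of \<open>B\<close> fit this setting after multiplication by the sign of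
  \<open>B\<close>. The derivative is controlled only in the open strip because the dilogarithm is
  singular at the boundary point \<open>w = 0\<close>.\<close>

locale strip_map =
  fixes g g' :: "complex \<Rightarrow> complex" and c :: real
  assumes cont: "continuous_on {w. 0 \<le> Im w \<and> Im w \<le> pi} g"
    and deriv: "\<And>w. \<lbrakk>0 < Im w; Im w < pi\<rbrakk> \<Longrightarrow> (g has_field_derivative g' w) (at w)"
    and bound: "\<And>w. \<lbrakk>0 < Im w; Im w < pi\<rbrakk> \<Longrightarrow> c \<le> Im (g' w)"
    and c_pos: "0 < c"
    and Im_g_0: "Im (g 0) = 0"
    and Im_g_pi: "Im (g (\<i> * pi)) = 0"
begin

text \<open>The segment estimate is available only in the open strip. Both points are contracted
  towards the interior point \<open>\<i> * pi / 2\<close>, and continuity gives the estimate in the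
  limit.\<close>

lemma monotone:
  assumes u: "0 \<le> Im u" "Im u \<le> pi" and v: "0 \<le> Im v" "Im v \<le> pi"
  shows "c * (norm (v - u))\<^sup>2 \<le> Im ((g v - g u) * cnj (v - u))"
proof -
  define q where "q w e = w + of_real e * (\<i> * pi / 2 - w)" for w :: complex and e :: real
  have Im_q: "Im (q w e) = (1 - e) * Im w + e * (pi / 2)" for w e
    by (simp add: q_def algebra_simps)
  have q_in: "0 < Im (q w e) \<and> Im (q w e) < pi"
    if "0 \<le> Im w" "Im w \<le> pi" "0 < e" "e < 1" for w e
  proof -
    have "(1 - e) * Im w \<le> (1 - e) * pi" "0 \<le> (1 - e) * Im w" "0 < e * (pi / 2)"
      using that by (auto intro!: mult_left_mono mult_nonneg_nonneg mult_pos_pos)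
    then show ?thesis unfolding Im_q by (auto simp: algebra_simps)
  qed
  have conv: "convex {w. 0 < Im w \<and> Im w < pi}"
    using convex_Int[OF convex_halfspace_Im_gt convex_halfspace_Im_lt]
    by (simp add: Collect_conj_eq)
  have ev: "\<forall>\<^sub>F e in at_right (0::real). 0 < e \<and> e < 1"
    using eventually_at_right_real[of 0 1] by simp
  have q_lim: "((\<lambda>e. q w e) \<longlongrightarrow> w) (at_right 0)" for w
    unfolding q_def by (auto intro!: tendsto_eq_intros)
  have g_lim: "((\<lambda>e. g (q w e)) \<longlongrightarrow> g w) (at_right 0)" if "0 \<le> Im w" "Im w \<le> pi" for w
  proof (rule continuous_on_tendsto_compose[OF cont q_lim])
    show "\<forall>\<^sub>F e in at_right 0. q w e \<in> {w. 0 \<le> Im w \<and> Im w \<le> pi}"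
      using ev by eventually_elim (use q_in[OF that] in \<open>auto intro: less_imp_le\<close>)
  qed (use that in auto)
  show ?thesis
  proof (rule tendsto_le)
    show "((\<lambda>e. c * (norm (q v e - q u e))\<^sup>2) \<longlongrightarrow> c * (norm (v - u))\<^sup>2) (at_right 0)"
      by (intro tendsto_intros q_lim)
    show "((\<lambda>e. Im ((g (q v e) - g (q u e)) * cnj (q v e - q u e))) \<longlongrightarrow>
            Im ((g v - g u) * cnj (v - u))) (at_right 0)"
      by (intro tendsto_intros q_lim g_lim u v)
    show "\<forall>\<^sub>F e in at_right 0. c * (norm (q v e - q u e))\<^sup>2
            \<le> Im ((g (q v e) - g (q u e)) * cnj (q v e - q u e))"
      using ev
      by eventually_elim
        (rule Im_diff_mult_cnj_ge[OF conv, of _ _ g g'], use q_in u v deriv bound in auto)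
  qed simp
qed

lemma inj: "inj_on g {w. 0 \<le> Im w \<and> Im w \<le> pi}"
proof (rule inj_onI, rule ccontr)
  fix u v assume uv: "u \<in> {w. 0 \<le> Im w \<and> Im w \<le> pi}" "v \<in> {w. 0 \<le> Im w \<and> Im w \<le> pi}"
    and eq: "g u = g v" and "u \<noteq> v"
  then have "c * (norm (v - u))\<^sup>2 > 0" using c_pos by simp
  with monotone[of u v] uv eq show False by simp
qed

text \<open>Compare \<open>w\<close> with \<open>0\<close> and with \<open>\<i> * pi\<close>. The
  differences of \<open>g\<close> are real, so the monotonicity expression is a real difference
  times a vertical distance of known sign.\<close>

lemma real_value_bounds:
  assumes w: "0 < Im w" "Im w < pi" and r: "g w = of_real r"
  shows "Re (g (\<i> * pi)) < r" "r < Re (g 0)"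
proof -
  have *: "0 < c * (norm (w - u))\<^sup>2" if "w \<noteq> u" for u using that c_pos by simp
  have "w \<noteq> 0" "w \<noteq> \<i> * pi" using w by auto
  note pos = this[THEN *]
  have "0 < Im ((g w - g 0) * cnj (w - 0))"
    using w by (intro less_le_trans[OF pos(1)] monotone) auto
  also have "\<dots> = (Re (g 0) - r) * Im w"
    using Im_g_0 r by (simp add: algebra_simps)
  finally show "r < Re (g 0)"
    using w by (simp add: zero_less_mult_iff)
  have "0 < Im ((g w - g (\<i> * pi)) * cnj (w - \<i> * pi))"
    using w by (intro less_le_trans[OF pos(2)] monotone) auto
  also have "\<dots> = (r - Re (g (\<i> * pi))) * (pi - Im w)"
    using Im_g_pi r by (simp add: algebra_simps)
  finally show "Re (g (\<i> * pi)) < r"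
    using w by (simp add: zero_less_mult_iff)
qed

text \<open>
  On every horizontal line \<open>Im g\<close> increases at rate at least \<open>c\<close>, so \<open>Im g = 0\<close> is a curve
  \<open>t \<mapsto> s t + \<i> t\<close> from \<open>0\<close> to \<open>\<i> \<pi>\<close>, and the intermediate value theorem applies to
  \<open>Re g\<close> along it.
\<close>

lemma real_value_attained:
  assumes r: "Re (g (\<i> * pi)) < r" "r < Re (g 0)"
  shows "\<exists>w. 0 < Im w \<and> Im w < pi \<and> g w = of_real r"
proof -
  have slope: "c * \<bar>x - y\<bar> \<le> \<bar>Im (g (Complex x t)) - Im (g (Complex y t))\<bar>"
    and slope': "x \<le> y \<Longrightarrow> c * (y - x) \<le> Im (g (Complex y t)) - Im (g (Complex x t))"
    if "0 \<le> t" "t \<le> pi" for x y t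
  proof -
    have *: "c * (y - x) \<le> Im (g (Complex y t)) - Im (g (Complex x t))" if "x \<le> y" for x y
    proof (cases "x = y")
      case False
      \<comment> \<open>Points at equal height differ by a real number, so \<open>cnj\<close> drops
        out and the estimate concerns \<open>Im g\<close> itself.\<close>
      have diff: "Complex y t - Complex x t = of_real (y - x)" by (simp add: complex_eq_iff)
      have "(y - x) * (c * (y - x)) \<le> (y - x) * (Im (g (Complex y t)) - Im (g (Complex x t)))"
        using monotone[of "Complex x t" "Complex y t"] \<open>0 \<le> t\<close> \<open>t \<le> pi\<close>
        unfolding diff by (simp add: power2_eq_square algebra_simps del: of_real_diff)
      then show ?thesis using False that by (subst (asm) mult_le_cancel_left_pos) auto
    qed simp
    show "x \<le> y \<Longrightarrow> c * (y - x) \<le> Im (g (Complex y t)) - Im (g (Complex x t))" by (rule *)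
    show "c * \<bar>x - y\<bar> \<le> \<bar>Im (g (Complex x t)) - Im (g (Complex y t))\<bar>"
      using *[of x y] *[of y x] by (cases "x \<le> y") (auto simp: abs_if)
  qed
  have "\<exists>x. Im (g (Complex x t)) = 0" if t: "0 \<le> t" "t \<le> pi" for t
  proof -
    \<comment> \<open>Moving by \<open>K\<close> from the imaginary axis changes \<open>Im g\<close>
      by at least its absolute value there, which forces a sign change on
      \<open>{- K..K}\<close>.\<close>
    define K where "K = \<bar>Im (g (Complex 0 t))\<bar> / c"
    have K: "0 \<le> K" "c * K = \<bar>Im (g (Complex 0 t))\<bar>" using c_pos by (auto simp: K_def)
    have "continuous_on {- K..K} (\<lambda>x. g (Complex x t))"
      by (rule continuous_on_compose2[OF cont])
        (use t in \<open>auto simp: Complex_eq intro!: continuous_intros\<close>)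
    then have "continuous_on {- K..K} (\<lambda>x. Im (g (Complex x t)))"
      by (intro continuous_intros)
    moreover have "Im (g (Complex (- K) t)) \<le> 0" "0 \<le> Im (g (Complex K t))"
      using slope'[OF t, of "- K" 0] slope'[OF t, of 0 K] K by auto
    ultimately show ?thesis using IVT'[of "\<lambda>x. Im (g (Complex x t))" "- K" 0 K] K(1) by auto
  qed
  then obtain s where s: "\<And>t. \<lbrakk>0 \<le> t; t \<le> pi\<rbrakk> \<Longrightarrow> Im (g (Complex (s t) t)) = 0" by metis
  have s_cont: "continuous_on {0..pi} s"
    unfolding continuous_on_def
  proof
    fix t assume t: "t \<in> {0..pi}"
    \<comment> \<open>Since \<open>Im g\<close> vanishes at \<open>Complex (s x) x\<close>, the
      slope estimate at height \<open>x\<close> bounds the distance of \<open>s x\<close> and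
      \<open>s t\<close> by \<open>h x\<close>, which tends to \<open>h t = 0\<close>.\<close>
    define h where "h x = \<bar>Im (g (Complex (s t) x))\<bar> / c" for x
    have "continuous_on {0..pi} (\<lambda>x. g (Complex (s t) x))"
      by (rule continuous_on_compose2[OF cont]) (auto simp: Complex_eq intro!: continuous_intros)
    then have "continuous_on {0..pi} h"
      unfolding h_def using c_pos by (intro continuous_intros) auto
    then have "(h \<longlongrightarrow> h t) (at t within {0..pi})" using t by (simp add: continuous_on_def)
    moreover have "h t = 0" using s t by (simp add: h_def)
    moreover have "\<forall>\<^sub>F x in at t within {0..pi}. norm (s x - s t) \<le> h x"
      unfolding eventually_at_filter
    proof (intro always_eventually allI impI)
      fix x assume "x \<in> {0..pi}"
      with slope[of x "s x" "s t"] s[of x] c_pos show "norm (s x - s t) \<le> h x"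
        by (simp add: h_def field_simps)
    qed
    ultimately have "((\<lambda>x. s x - s t) \<longlongrightarrow> 0) (at t within {0..pi})"
      by (auto intro: Lim_null_comparison)
    then show "(s \<longlongrightarrow> s t) (at t within {0..pi})" by (simp add: LIM_zero_iff)
  qed
  \<comment> \<open>The values of \<open>s\<close> come from a choice, but the slope estimate makes
    the zero on each line unique; hence the curve runs from \<open>0\<close> to
    \<open>\<i> * pi\<close>.\<close>
  have s0: "Complex (s 0) 0 = 0"
    using slope[of 0 "s 0" 0] s[of 0] Im_g_0 c_pos
    by (simp add: zero_complex.code[symmetric] mult_le_0_iff complex_eq_iff)
  have s_pi: "Complex (s pi) pi = \<i> * pi"
  proof -
    have *: "Complex 0 pi = \<i> * pi" by (simp add: complex_eq_iff)
    show ?thesis using slope[of pi "s pi" 0] s[of pi] Im_g_pi c_pos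
      unfolding * by (simp add: mult_le_0_iff complex_eq_iff)
  qed
  have "continuous_on {0..pi} (\<lambda>t. g (Complex (s t) t))"
    by (rule continuous_on_compose2[OF cont])
      (auto simp: Complex_eq intro!: continuous_intros s_cont)
  then have "continuous_on {0..pi} (\<lambda>t. Re (g (Complex (s t) t)))" by (intro continuous_intros)
  then obtain t where t: "0 \<le> t" "t \<le> pi" "Re (g (Complex (s t) t)) = r"
    using IVT2'[of "\<lambda>t. Re (g (Complex (s t) t))" pi r 0] r s0 s_pi by (auto intro: less_imp_le)
  moreover have "t \<noteq> 0" "t \<noteq> pi" using t r s0 s_pi by auto
  ultimately show ?thesis
    using s[of t] by (intro exI[of _ "Complex (s t) t"]) (auto simp: complex_eq_iff)
qed

end

section \<open>Inversion formula and boundary values\<close>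

text \<open>The term for \<open>n = 0\<close> is a division by zero and hence \<open>0\<close>.
  Unlike the integral on the cut plane, the series also covers the point \<open>1\<close> and is
  continuous there on the closed disc.\<close>

definition dilog_sum :: "complex \<Rightarrow> complex" where
  "dilog_sum z = (\<Sum>n. z ^ n / of_nat n ^ 2)"

lemma sums_inverse_squares: "(\<lambda>n. 1 / real n ^ 2) sums (pi\<^sup>2 / 6)"
  using inverse_squares_sums
  by (subst sums_Suc_iff[symmetric, where f = "\<lambda>n. 1 / (real n)\<^sup>2", simplified]) (simp add: add.commute)

lemma norm_dilog_term_le:
  assumes "norm (z::complex) \<le> 1"
  shows "norm (z ^ n / of_nat n ^ 2) \<le> 1 / real n ^ 2"
  using assms by (simp add: norm_divide norm_power power_le_one divide_right_mono)

lemma dilog_sum_sums: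
  assumes "norm z \<le> 1"
  shows "(\<lambda>n. z ^ n / of_nat n ^ 2) sums dilog_sum z"
  unfolding dilog_sum_def
  by (intro summable_sums summable_comparison_test'[OF sums_summable[OF sums_inverse_squares]] norm_dilog_term_le assms)

lemma continuous_on_dilog_sum: "continuous_on (cball 0 1) dilog_sum"
proof -
  have "uniform_limit (cball 0 1) (\<lambda>N w. \<Sum>n<N. w ^ n / of_nat n ^ 2) dilog_sum sequentially"
    unfolding dilog_sum_def
    by (rule Weierstrass_m_test[OF norm_dilog_term_le sums_summable[OF sums_inverse_squares]]) simp
  moreover have "continuous_on (cball 0 1) (\<lambda>w::complex. \<Sum>n<N. w ^ n / of_nat n ^ 2)" for N
    unfolding divide_inverse by (intro continuous_intros)
  ultimately show ?thesis
    by (intro uniform_limit_theorem[where F = sequentially]) (simp_all add: always_eventually)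
qed

lemma dilog_sum_1: "dilog_sum 1 = (of_real pi)\<^sup>2 / 6"
  using dilog_sum_sums[of 1] sums_of_real[OF sums_inverse_squares, where ?'a = complex]
  by (simp add: sums_iff)

lemma norm_dilog_sum_le:
  assumes "norm z \<le> 1"
  shows "norm (dilog_sum z) \<le> pi\<^sup>2 / 6"
  using norm_suminf_le[OF norm_dilog_term_le[OF assms] sums_summable[OF sums_inverse_squares]]
    sums_unique[OF sums_inverse_squares] by (simp add: dilog_sum_def)

lemma Im_dilog_sum_of_real:
  assumes "\<bar>x\<bar> \<le> 1"
  shows "Im (dilog_sum (of_real x)) = 0"
proof -
  have "(\<lambda>n. Im (of_real x ^ n / of_nat n ^ 2)) sums Im (dilog_sum (of_real x))"
    using assms by (intro sums_Im dilog_sum_sums) simp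
  moreover have "Im (of_real x ^ n / of_nat n ^ 2) = 0" for n
    by (metis Im_complex_of_real of_real_divide of_real_of_nat_eq of_real_power)
  ultimately show ?thesis using sums_unique2 sums_zero by (metis (no_types, lifting) sums_cong)
qed

section \<open>The cut plane and conjugation\<close>

lemma not_in_cut_iff: "z \<notin> complex_of_real ` {1..} \<longleftrightarrow> Im z \<noteq> 0 \<or> Re z < 1"
  by (auto simp: image_iff complex_eq_iff not_le)

lemma open_cut_plane: "open (- complex_of_real ` {1..})"
proof -
  have "- complex_of_real ` {1..} = {u. 0 < Im u} \<union> {u. Im u < 0} \<union> {u. Re u < 1}"
    by (auto simp del: Compl_iff image_iff simp: Compl_iff[of _ "complex_of_real ` {1..}"] not_in_cut_iff)
  then show ?thesis
    by (simp add: open_Un open_halfspace_Im_gt open_halfspace_Im_lt open_halfspace_Re_lt)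
qed

lemma dilog_integral_0 [simp]: "dilog_integral 0 = 0"
  by (simp add: dilog_integral_def)

lemma dilog_integral_eq_dilog_sum:
  assumes "norm z \<le> 1" "z \<noteq> 1"
  shows "dilog_integral z = dilog_sum z"
proof -
  have "z \<notin> complex_of_real ` {1..}" using assms by auto
  then have "Li2 z = dilog_integral z" by (simp add: Li2_def)
  with Li2_sums[OF assms] dilog_sum_sums[OF assms(1)] show ?thesis
    using sums_unique2 by metis
qed

lemma dilog_integral_cnj:
  assumes "z \<notin> complex_of_real ` {1..}"
  shows "dilog_integral (cnj z) = cnj (dilog_integral z)"
proof (cases "z = 0")
  case False
  \<comment> \<open>Conjugation may be pulled through \<open>Ln\<close> because
    \<open>1 - of_real t * z\<close> stays off the branch cut along the whole segment.\<close>
  have nonpos: "1 - of_real t * z \<notin> \<real>\<^sub>\<le>\<^sub>0" if "t \<in> {0..1}" for t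
  proof
    assume "1 - of_real t * z \<in> \<real>\<^sub>\<le>\<^sub>0"
    then have *: "1 \<le> t * Re z" "t * Im z = 0" by (auto simp: complex_nonpos_Reals_iff)
    then have "t \<noteq> 0" "Im z = 0" by auto
    moreover have "t * Re z \<le> 1 * Re z"
      using that * mult_nonneg_nonpos[of t "Re z"] by (intro mult_right_mono) force+
    ultimately show False using assms * by (auto simp: not_in_cut_iff)
  qed
  have "contour_integral (linepath 0 (cnj z)) (\<lambda>u. Ln (1 - u) / u)
        = integral {0..1} (\<lambda>t. Ln (1 - of_real t * cnj z) / (of_real t * cnj z) * cnj z)"
    by (simp add: contour_integral_integral linepath_def scaleR_conv_of_real)
  also have "\<dots> = integral {0..1} (\<lambda>t. cnj (Ln (1 - of_real t * z) / (of_real t * z) * z))"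
    by (intro integral_cong) (simp add: cnj_Ln nonpos)
  also have "\<dots> = cnj (contour_integral (linepath 0 z) (\<lambda>u. Ln (1 - u) / u))"
    by (simp add: contour_integral_integral linepath_def scaleR_conv_of_real flip: integral_cnj)
  finally show ?thesis by (simp add: dilog_integral_def)
qed simp

text \<open>The point \<open>1 - z\<close> is in the open lower half-plane, where the principal
  argument lies strictly between \<open>- pi\<close> and \<open>0\<close>.\<close>

lemma Im_Ln_one_minus:
  assumes "0 < Im z"
  shows "0 < - Im (Ln (1 - z))" "- Im (Ln (1 - z)) < pi"
proof -
  have "Im (1 - z) < 0" using assms by simp
  then have "1 - z \<noteq> 0" by auto
  then show "0 < - Im (Ln (1 - z))" "- Im (Ln (1 - z)) < pi"
    using Im_Ln_pos_le[of "1 - z"] mpi_less_Im_Ln[of "1 - z"] Im_Ln_le_pi[of "1 - z"] assms by auto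
qed

lemma Im_exp_pos: "\<lbrakk>0 < Im w; Im w < pi\<rbrakk> \<Longrightarrow> 0 < Im (exp w)"
  by (simp add: Im_exp sin_gt_zero)

lemma dilog_integral_exp_deriv:
  assumes "exp w \<notin> complex_of_real ` {1..}"
  shows "((\<lambda>w. dilog_integral (exp w)) has_field_derivative - Ln (1 - exp w)) (at w)"
  using DERIV_chain2[OF dilog_integral_has_field_derivative[OF assms] DERIV_exp] by simp

text \<open>The derivative is an expression \<open>E\<close> with \<open>exp E = 1\<close>, hence an
  integer multiple of \<open>2 * pi * \<i>\<close>, and bounds on its imaginary part leave only
  \<open>0\<close>.\<close>

lemma dilog_inversion_deriv:
  assumes w: "0 < Im w" "Im w < pi"
  shows "((\<lambda>w. dilog_integral (exp w) + dilog_integral (exp (- w)) + (w - \<i> * pi)\<^sup>2 / 2)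
           has_field_derivative 0) (at w)"
proof -
  have Im1: "0 < Im (exp w)" using w by (rule Im_exp_pos)
  have cnj: "cnj (exp (- w)) = exp (- cnj w)" by (simp add: exp_cnj)
  have Im2: "0 < Im (exp (- cnj w))" using w by (intro Im_exp_pos) auto
  then have Im2': "Im (exp (- w)) < 0" unfolding cnj[symmetric] by simp
  have off: "exp w \<notin> complex_of_real ` {1..}" "exp (- w) \<notin> complex_of_real ` {1..}"
    using Im1 Im2' by (auto simp del: exp_minus simp: not_in_cut_iff)
  have nz: "1 - exp w \<noteq> 0" "1 - exp (- w) \<noteq> 0"
    using Im1 Im2' by (auto simp del: exp_minus)
  define E where "E = - Ln (1 - exp w) + Ln (1 - exp (- w)) + (w - \<i> * pi)"
  have "exp E = (1 - exp (- w)) / (1 - exp w) * (exp w * - 1)"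
    using nz unfolding E_def
    by (simp add: exp_add exp_diff exp_minus field_simps)
  also have "\<dots> = 1"
    using nz by (simp add: exp_minus field_simps)
  finally obtain n :: int where n: "Re E = 0" "Im E = of_int (2 * n) * pi"
    by (auto simp: exp_eq_1)
  \<comment> \<open>Conjugation moves \<open>exp (- w)\<close> to the upper half-plane. Each
    logarithmic term of \<open>E\<close> then has imaginary part between \<open>0\<close> and
    \<open>pi\<close>, and \<open>w - \<i> * pi\<close> has one between \<open>- pi\<close> and
    \<open>0\<close>.\<close>
  have "Im (Ln (1 - exp (- w))) = - Im (Ln (1 - exp (- cnj w)))"
  proof -
    have "1 - exp (- w) \<notin> \<real>\<^sub>\<le>\<^sub>0" using Im2' by (auto simp: complex_nonpos_Reals_iff simp del: exp_minus)
    then have "cnj (Ln (1 - exp (- w))) = Ln (1 - exp (- cnj w))"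
      using cnj_Ln[of "1 - exp (- w)"] by (simp add: cnj del: exp_minus)
    then show ?thesis by (metis add.inverse_inverse cnj.sel(2))
  qed
  then have "- pi < Im E" "Im E < 2 * pi"
    using Im_Ln_one_minus[OF Im1] Im_Ln_one_minus[OF Im2] w by (auto simp: E_def simp del: exp_minus)
  then have "- 1 < real_of_int (2 * n)" "real_of_int (2 * n) < 2"
    unfolding n using mult_less_cancel_right_pos[OF pi_gt_zero, of "- 1"]
      mult_less_cancel_right_pos[OF pi_gt_zero, of _ 2] by auto
  then have "n = 0" by linarith
  with n have "E = 0" by (simp add: complex_eq_iff)
  have "((\<lambda>w. dilog_integral (exp w) + dilog_integral (exp (- w)) + (w - \<i> * pi)\<^sup>2 / 2)
           has_field_derivative - Ln (1 - exp w) + (- Ln (1 - exp (- w))) * (- 1) + (w - \<i> * pi)) (at w)"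
    by (rule derivative_eq_intros dilog_integral_exp_deriv off
          DERIV_chain2[OF dilog_integral_exp_deriv, where g = uminus] refl | simp del: exp_minus)+
  also have "- Ln (1 - exp w) + (- Ln (1 - exp (- w))) * (- 1) + (w - \<i> * pi) = 0"
    using \<open>E = 0\<close> by (simp add: E_def del: exp_minus)
  finally show ?thesis .
qed

text \<open>One constant serves both claims. It is carried from the open strip to the segment from
  \<open>0\<close> to \<open>\<i> * pi\<close> by continuity of the series and evaluated at
  \<open>0\<close>, giving pi^2/3 - pi^2/2.\<close>

lemma dilog_sum_circle: "\<lbrakk>0 \<le> t; t \<le> pi\<rbrakk> \<Longrightarrow>
      dilog_sum (exp (\<i> * of_real t)) + dilog_sum (exp (- (\<i> * of_real t)))
         + (\<i> * of_real t - \<i> * of_real pi)\<^sup>2 / 2 = - (of_real pi)\<^sup>2 / 6" (is "_ \<Longrightarrow> _ \<Longrightarrow> ?F t = _")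
  and dilog_inversion: "\<lbrakk>0 < Im w; Im w < pi\<rbrakk> \<Longrightarrow>
      dilog_integral (exp w) + dilog_integral (exp (- w)) + (w - \<i> * pi)\<^sup>2 / 2 = - (of_real pi)\<^sup>2 / 6"
      (is "_ \<Longrightarrow> _ \<Longrightarrow> ?D w = _")
proof -
  define S where "S = {w. 0 < Im w \<and> Im w < pi}"
  have "convex S"
    using convex_Int[OF convex_halfspace_Im_gt convex_halfspace_Im_lt]
    by (simp add: S_def Collect_conj_eq)
  moreover have "(?D has_field_derivative 0) (at w within S)" if "w \<in> S" for w
    using dilog_inversion_deriv[of w] that by (auto simp: S_def has_field_derivative_at_within)
  ultimately obtain K where K: "\<And>w. w \<in> S \<Longrightarrow> ?D w = K"
    using has_field_derivative_zero_constant[of S ?D] by auto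
  have on_circle: "?F t = K" if "t \<in> {0<..<pi}" for t
  proof -
    have "Im (exp (\<i> * of_real t)) > 0" "Im (exp (- (\<i> * of_real t))) < 0"
      using that by (simp_all add: Im_exp sin_gt_zero del: exp_minus)
    then have "exp (\<i> * of_real t) \<noteq> 1" "exp (- (\<i> * of_real t)) \<noteq> 1"
      by (auto simp del: exp_minus)
    then show ?thesis using K[of "\<i> * of_real t"] that
      by (simp add: S_def dilog_integral_eq_dilog_sum del: exp_minus)
  qed
  have "continuous_on {0..pi} ?F"
    by (intro continuous_intros continuous_on_compose2[OF continuous_on_dilog_sum])
      (auto simp del: exp_minus)
  then have on_closure: "?F t = K" if "t \<in> {0..pi}" for t
    using that on_circle continuous_constant_on_closure[of "{0<..<pi}" ?F K t] by simp
  have "K = 2 * dilog_sum 1 - (of_real pi)\<^sup>2 / 2"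
    using on_closure[of 0] by (simp add: power_mult_distrib)
  then have "K = - (of_real pi)\<^sup>2 / 6" by (simp add: dilog_sum_1 field_simps)
  then show "\<lbrakk>0 \<le> t; t \<le> pi\<rbrakk> \<Longrightarrow> ?F t = - (of_real pi)\<^sup>2 / 6"
    and "\<lbrakk>0 < Im w; Im w < pi\<rbrakk> \<Longrightarrow> ?D w = - (of_real pi)\<^sup>2 / 6"
    using on_closure K by (auto simp: S_def)
qed

text \<open>At \<open>t = pi\<close> the two points of the circle coincide and the quadratic term
  vanishes.\<close>

lemma dilog_sum_minus_1: "dilog_sum (- 1) = - (of_real pi)\<^sup>2 / 12"
  using dilog_sum_circle[of pi] by (simp add: exp_minus field_simps)

text \<open>
  The continuous extension of \<open>w \<mapsto> Li\<^sub>2(e^w)\<close> to the closed strip \<open>0 \<le> Im w \<le> \<pi>\<close>; for \<open>Re w > 0\<close> the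
  inversion formula expresses it by the power series inside the unit disc.
\<close>

definition dilog_strip :: "complex \<Rightarrow> complex" where
  "dilog_strip w = (if Re w \<le> 0 then dilog_sum (exp w)
     else - (of_real pi)\<^sup>2 / 6 - (w - \<i> * pi)\<^sup>2 / 2 - dilog_sum (exp (- w)))"

lemma continuous_on_dilog_strip:
  "continuous_on {w. 0 \<le> Im w \<and> Im w \<le> pi} dilog_strip"
  unfolding dilog_strip_def
proof (rule continuous_on_cases_le)
  show "continuous_on {t \<in> {w. 0 \<le> Im w \<and> Im w \<le> pi}. Re t \<le> 0} (\<lambda>w. dilog_sum (exp w))"
    by (rule continuous_on_compose2[OF continuous_on_dilog_sum]) (auto intro!: continuous_intros)
  show "continuous_on {t \<in> {w. 0 \<le> Im w \<and> Im w \<le> pi}. 0 \<le> Re t}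
     (\<lambda>w. - (of_real pi)\<^sup>2 / 6 - (w - \<i> * pi)\<^sup>2 / 2 - dilog_sum (exp (- w)))"
    by (intro continuous_intros continuous_on_compose2[OF continuous_on_dilog_sum])
      (auto simp del: exp_minus)
next
  \<comment> \<open>On the imaginary axis both exponentials lie on the unit circle, so the circle
    identity makes the two pieces agree.\<close>
  fix w :: complex assume w: "w \<in> {w. 0 \<le> Im w \<and> Im w \<le> pi}" "Re w = 0"
  then have "w = \<i> * of_real (Im w)" by (simp add: complex_eq_iff)
  then show "dilog_sum (exp w) = - (of_real pi)\<^sup>2 / 6 - (w - \<i> * pi)\<^sup>2 / 2 - dilog_sum (exp (- w))"
    using dilog_sum_circle[of "Im w"] w by (simp add: algebra_simps del: exp_minus)
qed (intro continuous_intros)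

lemma dilog_strip_eq:
  assumes w: "0 < Im w" "Im w < pi"
  shows "dilog_strip w = dilog_integral (exp w)"
proof -
  have ne: "exp w \<noteq> 1" using Im_exp_pos[OF w] by auto
  show ?thesis
  proof (cases "Re w \<le> 0")
    case True
    with ne show ?thesis by (simp add: dilog_strip_def dilog_integral_eq_dilog_sum)
  next
    case False
    have "exp (- w) \<noteq> 1" using ne by (simp add: exp_minus)
    then have "dilog_integral (exp (- w)) = dilog_sum (exp (- w))"
      using False by (intro dilog_integral_eq_dilog_sum) (simp_all del: exp_minus)
    with False dilog_inversion[OF w] show ?thesis
      by (simp add: dilog_strip_def algebra_simps del: exp_minus)
  qed
qed

lemma dilog_strip_deriv:
  assumes w: "0 < Im w" "Im w < pi"
  shows "(dilog_strip has_field_derivative - Ln (1 - exp w)) (at w)"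
proof (rule has_field_derivative_transform_within_open)
  show "((\<lambda>w. dilog_integral (exp w)) has_field_derivative - Ln (1 - exp w)) (at w)"
    using Im_exp_pos[OF w] by (intro dilog_integral_exp_deriv) (auto simp: not_in_cut_iff)
  have "{w. 0 < Im w \<and> Im w < pi} = {w. 0 < Im w} \<inter> {w. Im w < pi}" by auto
  then show "open {w. 0 < Im w \<and> Im w < pi}"
    by (simp add: open_Int open_halfspace_Im_gt open_halfspace_Im_lt)
qed (use w in \<open>auto simp: dilog_strip_eq\<close>)

lemma dilog_strip_0: "dilog_strip 0 = (of_real pi)\<^sup>2 / 6"
  by (simp add: dilog_strip_def dilog_sum_1)

lemma dilog_strip_pi: "dilog_strip (\<i> * pi) = - (of_real pi)\<^sup>2 / 12"
  by (simp add: dilog_strip_def dilog_sum_minus_1)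

text \<open>The series at \<open>exp (- s)\<close> is real, so only the quadratic term
  contributes.\<close>

lemma Im_dilog_strip_of_real:
  assumes "0 \<le> s"
  shows "Im (dilog_strip (of_real s)) = pi * s"
proof (cases "s = 0")
  case True
  then show ?thesis by (simp add: dilog_strip_0 flip: of_real_power)
next
  case False
  have "Im (dilog_sum (exp (- of_real s))) = 0"
    using Im_dilog_sum_of_real[of "exp (- s)"] assms by (simp add: exp_of_real flip: of_real_minus del: exp_minus)
  with False assms show ?thesis
    by (simp add: dilog_strip_def power2_eq_square field_simps del: exp_minus)
qed

section \<open>Values on the cut\<close>

lemma Li2_off_cut: "z \<notin> complex_of_real ` {1..} \<Longrightarrow> Li2 z = dilog_integral z"
  by (simp add: Li2_def)

text \<open>The limit from below is the conjugate of the limit from above, and the latter is a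
  boundary value of the continuous \<open>dilog_strip\<close>.\<close>

lemma Li2_cut:
  assumes "1 \<le> x"
  shows "Li2 (of_real x) = cnj (dilog_strip (of_real (ln x)))"
proof -
  have "((\<lambda>y. Ln (Complex x (- y))) \<longlongrightarrow> Ln (Complex x (- 0))) (at_left 0)"
    using assms by (intro tendsto_intros) (auto simp: complex_nonpos_Reals_iff)
  also have "Ln (Complex x (- 0)) = of_real (ln x)"
    using assms Ln_of_real[of x] by (simp add: complex_of_real_def)
  finally have "((\<lambda>y. cnj (dilog_strip (Ln (Complex x (- y))))) \<longlongrightarrow> cnj (dilog_strip (of_real (ln x))))
      (at_left 0)"
  proof (intro tendsto_cnj continuous_on_tendsto_compose[OF continuous_on_dilog_strip])
    show "\<forall>\<^sub>F y in at_left 0. Ln (Complex x (- y)) \<in> {w. 0 \<le> Im w \<and> Im w \<le> pi}"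
      unfolding eventually_at_filter
    proof (intro always_eventually allI impI)
      fix y :: real assume "y \<in> {..<0}"
      then show "Ln (Complex x (- y)) \<in> {w. 0 \<le> Im w \<and> Im w \<le> pi}"
        using Im_Ln_pos_lt_imp[of "Complex x (- y)"] by simp
    qed
  qed auto
  moreover have "\<forall>\<^sub>F y in at_left 0. cnj (dilog_strip (Ln (Complex x (- y)))) = dilog_integral (Complex x y)"
    unfolding eventually_at_filter
  proof (intro always_eventually allI impI)
    fix y :: real assume "y \<in> {..<0}"
    then have y: "y < 0" by simp
    define z where "z = Complex x (- y)"
    have z: "0 < Im z" "z \<noteq> 0" "Complex x y = cnj z" using y by (auto simp: z_def complex_eq_iff)
    then have "z \<notin> complex_of_real ` {1..}" by (simp add: not_in_cut_iff)
    then show "cnj (dilog_strip (Ln (Complex x (- y)))) = dilog_integral (Complex x y)"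
      using z Im_Ln_pos_lt_imp[of z] by (simp add: dilog_strip_eq dilog_integral_cnj flip: z_def)
  qed
  ultimately have "((\<lambda>y. dilog_integral (Complex x y)) \<longlongrightarrow> cnj (dilog_strip (of_real (ln x)))) (at_left 0)"
    by (rule Lim_transform_eventually)
  then have "Lim (at_left 0) (\<lambda>y. dilog_integral (Complex x y)) = cnj (dilog_strip (of_real (ln x)))"
    by (intro tendsto_Lim) auto
  then show ?thesis using assms by (auto simp: Li2_def)
qed

section \<open>The branches of the dilogarithm\<close>

lemma pi_sq_multiple_eq_0_iff:
  "(of_real pi)\<^sup>2 * of_int k = (0::complex) \<longleftrightarrow> k = 0"
  by simp

text \<open>The imaginary part is \<open>pi * (2 * B - 1) * ln x\<close>, and
  \<open>2 * B - 1\<close> is odd, so only \<open>x = 1\<close> remains. There the value is pi^2/6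
  times \<open>1 + 24 * A\<close>.\<close>

lemma \<phi>_cut_nonzero:
  assumes "1 \<le> x"
  shows "\<phi> A B (of_real x) \<noteq> 0"
proof
  assume zero: "\<phi> A B (of_real x) = 0"
  have eq: "\<phi> A B (of_real x) = cnj (dilog_strip (of_real (ln x))) + of_real (4 * pi\<^sup>2 * of_int A)
      + \<i> * of_real (2 * pi * of_int B * ln x)"
    using assms by (simp add: \<phi>_def Li2_cut Ln_of_real)
  from zero have "ln x * of_int (2 * B - 1) = 0"
    unfolding eq using assms Im_dilog_strip_of_real[of "ln x"]
    by (auto simp: complex_eq_iff algebra_simps)
  moreover have "2 * B - 1 \<noteq> 0" by presburger
  ultimately have "ln x = 0" by (metis mult_eq_0_iff of_int_eq_0_iff)
  with zero have "(of_real pi)\<^sup>2 * of_int (1 + 24 * A) = (0::complex)"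
    unfolding eq by (simp add: dilog_strip_0 field_simps)
  then have "1 + 24 * A = 0" by (simp only: pi_sq_multiple_eq_0_iff)
  then show False by presburger
qed

lemma \<phi>_off_cut:
  assumes "z \<notin> complex_of_real ` {1..}"
  shows "\<phi> A B z = dilog_integral z + 4 * (of_real pi)\<^sup>2 * of_int A + 2 * of_real pi * \<i> * of_int B * Ln z"
  using assms by (simp add: \<phi>_def Li2_off_cut)

lemma Im_dilog_integral_of_real:
  assumes "x < 1"
  shows "Im (dilog_integral (of_real x)) = 0"
proof -
  have "complex_of_real x \<notin> complex_of_real ` {1..}" using assms by (simp add: not_in_cut_iff)
  from dilog_integral_cnj[OF this] show ?thesis by (simp add: complex_eq_iff)
qed

text \<open>On the real line below \<open>1\<close> the dilogarithm is real, so a zero needs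
  \<open>ln \<bar>x\<bar> = 0\<close>, that is \<open>x = - 1\<close>. There
  \<open>12 * \<phi>\<close> is pi^2 times an odd integer.\<close>

lemma \<phi>_zero_not_real:
  assumes "B \<noteq> 0" "z \<noteq> 0" "\<phi> A B z = 0"
  shows "Im z \<noteq> 0"
proof
  assume "Im z = 0"
  then obtain x where x: "z = of_real x" by (metis complex_is_Real_iff Reals_cases)
  have "x < 1" using \<phi>_cut_nonzero[of x A B] assms(3) x by force
  then have off: "z \<notin> complex_of_real ` {1..}" by (auto simp: x)
  have "Im (2 * of_real pi * \<i> * of_int B * Ln z) = 2 * pi * of_int B * ln \<bar>x\<bar>"
    using assms(2) by (simp add: x Re_Ln)
  then have "ln \<bar>x\<bar> = 0"
    using assms(1,3) \<phi>_off_cut[OF off, of A B] Im_dilog_integral_of_real[OF \<open>x < 1\<close>]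
    by (simp add: x complex_eq_iff)
  then have "x = - 1" using assms(2) x \<open>x < 1\<close> by (auto simp: abs_if split: if_splits)
  then have "(of_real pi)\<^sup>2 * of_int (48 * A - 24 * B - 1) = (0::complex)"
    using \<phi>_off_cut[OF off, of A B] assms(3)
    by (simp add: x dilog_integral_eq_dilog_sum dilog_sum_minus_1 field_simps power2_eq_square)
  then have "48 * A - 24 * B - 1 = 0" by (simp only: pi_sq_multiple_eq_0_iff)
  then show False by presburger
qed

lemma \<phi>_cnj:
  assumes "Im z \<noteq> 0"
  shows "\<phi> A B (cnj z) = cnj (\<phi> A (- B) z)"
  using assms by (simp add: \<phi>_off_cut not_in_cut_iff dilog_integral_cnj cnj_Ln complex_nonpos_Reals_iff)

section \<open>Derivative and simplicity of zeros\<close>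

lemma \<phi>_deriv:
  assumes "z \<notin> complex_of_real ` {1..}" "z \<noteq> 0" "B = 0 \<or> z \<notin> \<real>\<^sub>\<le>\<^sub>0"
  shows "(\<phi> A B has_field_derivative (- Ln (1 - z) + 2 * of_real pi * \<i> * of_int B) / z) (at z)"
proof (rule has_field_derivative_transform_within_open[OF _ open_cut_plane])
  have L: "((\<lambda>z. 2 * of_real pi * \<i> * of_int B * Ln z) has_field_derivative 2 * of_real pi * \<i> * of_int B / z) (at z)"
    \<comment> \<open>For \<open>B = 0\<close> the logarithmic term vanishes, so the negative axis
      is allowed; the zeros for \<open>A > 0\<close> lie there.\<close>
    using assms by (cases "B = 0") (auto intro!: derivative_eq_intros simp: field_simps)
  note D = dilog_integral_has_field_derivative[OF assms(1)]
  show "((\<lambda>z. dilog_integral z + 4 * (of_real pi)\<^sup>2 * of_int A + 2 * of_real pi * \<i> * of_int B * Ln z)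
       has_field_derivative (- Ln (1 - z) + 2 * of_real pi * \<i> * of_int B) / z) (at z)"
    by (rule DERIV_cong[OF DERIV_add[OF DERIV_add[OF D DERIV_const] L]])
      (use assms(2) in \<open>simp add: field_simps\<close>)
qed (use assms in \<open>auto simp: \<phi>_off_cut\<close>)

lemma simple_zeroI_deriv:
  assumes "f holomorphic_on S" "open S" "z \<in> S" "f z = 0" "(f has_field_derivative d) (at z)" "d \<noteq> 0"
  shows "simple_zero f z"
proof -
  have "zorder f z = 1"
    by (rule zorder_zero_eqI[OF assms(1-3)]) (use assms in \<open>auto simp: DERIV_imp_deriv\<close>)
  with assms show ?thesis
    by (auto simp: simple_zero_def analytic_at)
qed

text \<open>A multiple zero would give \<open>Ln (1 - z) = 2 * pi * \<i> * B\<close>, and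
  exponentiating yields \<open>z = 0\<close>.\<close>

lemma \<phi>_simple_zero:
  assumes z: "z \<notin> complex_of_real ` {1..}" "z \<noteq> 0" "B = 0 \<or> z \<notin> \<real>\<^sub>\<le>\<^sub>0" and zero: "\<phi> A B z = 0"
  shows "simple_zero (\<phi> A B) z"
proof (rule simple_zeroI_deriv)
  define S where "S = - complex_of_real ` {1..} \<inter> - {0} \<inter> (if B = 0 then UNIV else - \<real>\<^sub>\<le>\<^sub>0)"
  show "open S"
    unfolding S_def by (intro open_Int open_cut_plane) (auto simp: open_Compl)
  then show "\<phi> A B holomorphic_on S"
    using \<phi>_deriv by (fastforce simp: holomorphic_on_open S_def split: if_splits)
  show "(\<phi> A B has_field_derivative (- Ln (1 - z) + 2 * of_real pi * \<i> * of_int B) / z) (at z)"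
    using z by (rule \<phi>_deriv)
  show "z \<in> S" using z by (auto simp: S_def)
  have "Ln (1 - z) \<noteq> 2 * of_real pi * \<i> * of_int B"
  proof
    assume "Ln (1 - z) = 2 * of_real pi * \<i> * of_int B"
    moreover have "1 - z \<noteq> 0" using z(1) by (auto simp: not_in_cut_iff)
    ultimately have "1 - z = exp (2 * of_real pi * \<i> * of_int B)"
      using exp_Ln[of "1 - z"] by simp
    also have "\<dots> = 1" by (subst exp_eq_1) (auto intro!: exI[of _ B])
    finally show False using z(2) by simp
  qed
  then show "(- Ln (1 - z) + 2 * of_real pi * \<i> * of_int B) / z \<noteq> 0"
    using z(2) by (auto simp: add_eq_0_iff)
qed (rule zero)

text \<open>The origin needs its own argument, since the derivative formula above divides by
  \<open>z\<close>.\<close>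

lemma \<phi>_0_0_simple_zero: "simple_zero (\<phi> 0 0) 0"
proof (rule simple_zeroI_deriv[OF _ open_cut_plane])
  have "dilog_integral holomorphic_on - complex_of_real ` {1..}"
    using dilog_integral_has_field_derivative by (fastforce simp: holomorphic_on_open[OF open_cut_plane])
  then show "\<phi> 0 0 holomorphic_on - complex_of_real ` {1..}"
    by (rule holomorphic_transform) (simp add: \<phi>_off_cut)
  show "(\<phi> 0 0 has_field_derivative 1) (at 0)"
    by (rule has_field_derivative_transform_within_open[OF _ open_cut_plane])
      (use dilog_integral_has_field_derivative[of 0] in \<open>auto simp: \<phi>_off_cut not_in_cut_iff\<close>)
qed (auto simp: \<phi>_off_cut not_in_cut_iff)

section \<open>Zeros in the upper half-plane\<close>

lemma strip_map_dilog:
  fixes B :: int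
  assumes "B \<noteq> 0"
  defines "\<sigma> \<equiv> sgn (of_int B) :: real"
  shows "strip_map (\<lambda>w. of_real \<sigma> * (dilog_strip w + 2 * of_real pi * \<i> * of_int B * w))
          (\<lambda>w. of_real \<sigma> * (- Ln (1 - exp w) + 2 * of_real pi * \<i> * of_int B)) pi"
proof
  show "continuous_on {w. 0 \<le> Im w \<and> Im w \<le> pi}
          (\<lambda>w. of_real \<sigma> * (dilog_strip w + 2 * of_real pi * \<i> * of_int B * w))"
    by (intro continuous_intros continuous_on_dilog_strip)
next
  fix w :: complex assume w: "0 < Im w" "Im w < pi"
  show "((\<lambda>w. of_real \<sigma> * (dilog_strip w + 2 * of_real pi * \<i> * of_int B * w)) has_field_derivative
          of_real \<sigma> * (- Ln (1 - exp w) + 2 * of_real pi * \<i> * of_int B)) (at w)"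
    using dilog_strip_deriv[OF w] by (auto intro!: derivative_eq_intros)
  note Ln = Im_Ln_one_minus[OF Im_exp_pos[OF w]]
  have Im: "Im (of_real \<sigma> * (- Ln (1 - exp w) + 2 * of_real pi * \<i> * of_int B))
      = \<sigma> * (- Im (Ln (1 - exp w)) + 2 * (pi * of_int B))" by simp
  define p where "p = pi * of_int B"
  \<comment> \<open>The term with \<open>B\<close> contributes at least \<open>2 * pi\<close> after
    the sign change. The logarithm adds to it for \<open>B > 0\<close> and takes away less than
    \<open>pi\<close> for \<open>B < 0\<close>, so \<open>pi\<close> serves both cases.\<close>
  show "pi \<le> Im (of_real \<sigma> * (- Ln (1 - exp w) + 2 * of_real pi * \<i> * of_int B))"
  proof (cases "B > 0")
    case True
    then have "pi * 1 \<le> p" unfolding p_def by (intro mult_left_mono) auto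
    moreover have "\<sigma> = 1" using True by (simp add: \<sigma>_def)
    moreover have "pi \<le> - Im (Ln (1 - exp w)) + 2 * p"
      using Ln pi_gt_zero \<open>pi * 1 \<le> p\<close> by linarith
    ultimately show ?thesis unfolding Im by (simp add: p_def)
  next
    case False
    with assms have "B < 0" by simp
    then have "of_int B \<le> (- 1 :: real)" by linarith
    then have "p \<le> pi * - 1" unfolding p_def by (intro mult_left_mono) auto
    moreover have "\<sigma> = - 1" using \<open>B < 0\<close> by (simp add: \<sigma>_def)
    moreover have "pi \<le> Im (Ln (1 - exp w)) - 2 * p"
      using Ln pi_gt_zero \<open>p \<le> pi * - 1\<close> by linarith
    ultimately show ?thesis unfolding Im by (simp add: p_def)
  qed
qed (auto simp: dilog_strip_0 dilog_strip_pi simp flip: of_real_power)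

text \<open>For \<open>B > 0\<close> the zeros with \<open>A \<ge> 0\<close> lie in the upper
  half-plane; those with \<open>A < 0\<close> lie in the lower one and appear here with
  \<open>- B\<close> in place of \<open>B\<close>.\<close>

definition upper_zero_cond :: "int \<Rightarrow> int \<Rightarrow> bool" where
  "upper_zero_cond A B \<longleftrightarrow> (0 < B \<and> 0 \<le> A \<and> 2 * A \<le> B) \<or> (B < 0 \<and> B < 2 * A \<and> A < 0)"

lemma \<phi>_zeros_upper:
  fixes A B :: int
  assumes B: "B \<noteq> 0"
  defines "Z \<equiv> {z. 0 < Im z \<and> \<phi> A B z = 0}"
  shows "if upper_zero_cond A B then \<exists>z. Z = {z} else Z = {}"
proof -
  define \<sigma> :: real where "\<sigma> = sgn (of_int B)"
  define g where "g = (\<lambda>w. of_real \<sigma> * (dilog_strip w + 2 * of_real pi * \<i> * of_int B * w))"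
  \<comment> \<open>A zero means that the strip function equals -4 pi^2 A; \<open>g\<close> carries
    the extra factor \<open>\<sigma>\<close>.\<close>
  define r where "r = - \<sigma> * (4 * pi\<^sup>2 * of_int A)"
  interpret strip_map g "\<lambda>w. of_real \<sigma> * (- Ln (1 - exp w) + 2 * of_real pi * \<i> * of_int B)" pi
    unfolding g_def \<sigma>_def using B by (rule strip_map_dilog)
  have \<sigma>: "\<sigma> = 1 \<and> B > 0 \<or> \<sigma> = - 1 \<and> B < 0" using B by (auto simp: \<sigma>_def sgn_if)
  have zero_iff: "\<phi> A B (exp w) = 0 \<longleftrightarrow> g w = of_real r" if "0 < Im w" "Im w < pi" for w
  proof -
    have "exp w \<notin> complex_of_real ` {1..}" using Im_exp_pos[OF that] by (simp add: not_in_cut_iff)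
    then have "\<phi> A B (exp w) = dilog_strip w + 4 * (of_real pi)\<^sup>2 * of_int A + 2 * of_real pi * \<i> * of_int B * w"
      using that by (simp add: \<phi>_off_cut dilog_strip_eq Ln_exp)
    then have "g w - of_real r = of_real \<sigma> * \<phi> A B (exp w)"
      by (simp add: g_def r_def algebra_simps)
    then show ?thesis using \<sigma> by auto
  qed
  have bounds: "Re (g (\<i> * pi)) < r \<and> r < Re (g 0) \<longleftrightarrow> upper_zero_cond A B"
  proof -
    have g0: "Re (g 0) = pi\<^sup>2 * (\<sigma> / 6)"
      by (simp add: g_def dilog_strip_0 flip: of_real_power)
    have "g (\<i> * pi) = of_real (pi\<^sup>2 * (\<sigma> * (- 1 / 12 - 2 * of_int B)))"
      by (simp add: g_def dilog_strip_pi power2_eq_square algebra_simps)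
    then have gpi: "Re (g (\<i> * pi)) = pi\<^sup>2 * (\<sigma> * (- 1 / 12 - 2 * of_int B))" by simp
    have cancel: "pi\<^sup>2 * a < pi\<^sup>2 * b \<longleftrightarrow> a < b" for a b by simp
    have r: "r = pi\<^sup>2 * (- 4 * \<sigma> * of_int A)" by (simp add: r_def)
    have "Re (g (\<i> * pi)) < r \<and> r < Re (g 0) \<longleftrightarrow>
        \<sigma> * (- 1 / 12 - 2 * of_int B) < - 4 * \<sigma> * of_int A \<and> - 4 * \<sigma> * of_int A < \<sigma> / 6"
      by (simp only: g0 gpi r cancel)
    also have "\<dots> \<longleftrightarrow> upper_zero_cond A B"
      using \<sigma>
    proof (elim disjE conjE)
      assume \<sigma>: "\<sigma> = 1" and "0 < B"
      \<comment> \<open>After cancelling pi^2 the bounds read \<open>2 * A < B + 1/24\<close> and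
        \<open>- 1/24 < A\<close>, and integrality rounds them. For \<open>\<sigma> = - 1\<close>
        the same inequalities are reversed and round to strict ones, which makes the final range
        half-open.\<close>
      have e1: "\<sigma> * (- 1 / 12 - 2 * of_int B) < - 4 * \<sigma> * of_int A \<longleftrightarrow> 2 * A \<le> B"
        unfolding \<sigma> mult_1_left mult_1_right by (rule iffI; linarith)
      have e2: "- 4 * \<sigma> * of_int A < \<sigma> / 6 \<longleftrightarrow> 0 \<le> A"
        unfolding \<sigma> mult_1_left mult_1_right by (rule iffI; linarith)
      have "\<not> B < 0" using \<open>0 < B\<close> by simp
      then show ?thesis unfolding upper_zero_cond_def e1 e2 using \<open>0 < B\<close> by blast
    next
      assume \<sigma>: "\<sigma> = - 1" and "B < 0"
      have e1: "\<sigma> * (- 1 / 12 - 2 * of_int B) < - 4 * \<sigma> * of_int A \<longleftrightarrow> B < 2 * A"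
        unfolding \<sigma> mult_minus1 mult_minus1_right by (rule iffI; linarith)
      have e2: "- 4 * \<sigma> * of_int A < \<sigma> / 6 \<longleftrightarrow> A < 0"
        unfolding \<sigma> mult_minus1 mult_minus1_right by (rule iffI; linarith)
      have "\<not> 0 < B" using \<open>B < 0\<close> by simp
      then show ?thesis unfolding upper_zero_cond_def e1 e2 using \<open>B < 0\<close> by blast
    qed
    finally show ?thesis .
  qed
  have Z_imp: "upper_zero_cond A B \<and> (\<exists>w. 0 < Im w \<and> Im w < pi \<and> z = exp w \<and> g w = of_real r)" if "z \<in> Z" for z
  proof -
    have z: "0 < Im z" "z \<noteq> 0" "\<phi> A B z = 0" using that by (auto simp: Z_def)
    have w: "0 < Im (Ln z)" "Im (Ln z) < pi" using Im_Ln_pos_lt_imp[OF z(1)] by auto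
    then have "g (Ln z) = of_real r" using z by (simp flip: zero_iff)
    moreover from this real_value_bounds[OF w] have "upper_zero_cond A B" by (simp only: bounds[symmetric])
    moreover have "z = exp (Ln z)" using z by simp
    ultimately show ?thesis using w by blast
  qed
  show ?thesis
  proof (cases "upper_zero_cond A B")
    case True
    then have "Re (g (\<i> * pi)) < r" "r < Re (g 0)" by (simp_all only: bounds[symmetric])
    then obtain w where w: "0 < Im w" "Im w < pi" "g w = of_real r"
      using real_value_attained by blast
    then have "exp w \<in> Z" using Im_exp_pos[OF w(1,2)] zero_iff[OF w(1,2)] by (simp add: Z_def)
    moreover have "z = exp w" if zZ: "z \<in> Z" for z
    proof -
      obtain v where v: "0 < Im v" "Im v < pi" "z = exp v" "g v = of_real r"
        using Z_imp[OF zZ] by blast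
      have "v = w" by (rule inj_onD[OF inj]) (use v w in simp_all)
      with v show ?thesis by simp
    qed
    ultimately show ?thesis using True by auto
  next
    case False
    then show ?thesis using Z_imp by auto
  qed
qed

text \<open>There are no real zeros, and conjugation exchanges the half-planes while replacing
  \<open>B\<close> by \<open>- B\<close>.\<close>

lemma \<phi>_zeros_eq:
  assumes "B \<noteq> 0"
  shows "\<phi>_zeros A B = {z. 0 < Im z \<and> \<phi> A B z = 0} \<union> cnj ` {z. 0 < Im z \<and> \<phi> A (- B) z = 0}"
proof (intro set_eqI iffI)
  fix z assume "z \<in> \<phi>_zeros A B"
  then have z: "z \<noteq> 0" "\<phi> A B z = 0" using assms by (auto simp: \<phi>_zeros_def \<phi>_domain_def)
  note nr = \<phi>_zero_not_real[OF assms z]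
  show "z \<in> {z. 0 < Im z \<and> \<phi> A B z = 0} \<union> cnj ` {z. 0 < Im z \<and> \<phi> A (- B) z = 0}"
  proof (cases "0 < Im z")
    case False
    with nr z \<phi>_cnj[of "cnj z" A B] show ?thesis
      by (intro UnI2 image_eqI[of _ _ "cnj z"]) auto
  qed (use z in auto)
next
  fix z assume "z \<in> {z. 0 < Im z \<and> \<phi> A B z = 0} \<union> cnj ` {z. 0 < Im z \<and> \<phi> A (- B) z = 0}"
  then show "z \<in> \<phi>_zeros A B"
    using assms by (auto simp: \<phi>_zeros_def \<phi>_domain_def \<phi>_cnj)
qed

section \<open>The case \<open>B = 0\<close>\<close>

text \<open>Along the ray from \<open>0\<close> to \<open>z\<close> the imaginary part has
  derivative \<open>- Im (Ln (1 - of_real t * z)) / t\<close>, which is positive. This excludes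
  non-real zeros for \<open>B = 0\<close>.\<close>

lemma Im_dilog_integral_pos:
  assumes "0 < Im z"
  shows "0 < Im (dilog_integral z)"
proof -
  define f where "f t = Im (dilog_integral (of_real t * z))" for t
  define d where "d u = (if u = 0 then 1 else - (Ln (1 - u) / u))" for u :: complex
  have f': "(f has_real_derivative Im (z * d (of_real t * z))) (at t)" if "0 \<le> t" for t
  proof -
    have "of_real t * z \<notin> complex_of_real ` {1..}"
      using assms that by (cases "t = 0") (auto simp: not_in_cut_iff)
    then have "(dilog_integral has_field_derivative d (of_real t * z)) (at (of_real t * z))"
      unfolding d_def by (rule dilog_integral_has_field_derivative)
    moreover have "((\<lambda>t. of_real t * z) has_vector_derivative z) (at t)"
      by (auto intro!: derivative_eq_intros)
    ultimately have "(dilog_integral \<circ> (\<lambda>t. of_real t * z) has_vector_derivative z * d (of_real t * z)) (at t)"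
      by (intro field_vector_diff_chain_at)
    then show ?thesis
      unfolding f_def o_def by (rule has_field_derivative_Im)
  qed
  have "f 0 < f 1"
  proof (rule DERIV_pos_imp_increasing_open[where f = f])
    fix t :: real assume t: "0 < t" "t < 1"
    have "z * d (of_real t * z) = - Ln (1 - of_real t * z) / of_real t"
      using assms t by (auto simp: d_def)
    then have "Im (z * d (of_real t * z)) = - Im (Ln (1 - of_real t * z)) / t"
      by simp
    also have "\<dots> > 0"
      using Im_Ln_one_minus(1)[of "of_real t * z"] assms t by (simp add: divide_neg_pos)
    finally show "\<exists>y. (f has_real_derivative y) (at t) \<and> 0 < y" using f'[of t] t by auto
  next
    show "continuous_on {0..1} f"
      using DERIV_isCont[OF f'] by (intro continuous_at_imp_continuous_on) auto
  qed simp
  then show ?thesis by (simp add: f_def)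
qed

lemma Re_dilog_integral_deriv:
  assumes "x < 1"
  shows "((\<lambda>x. Re (dilog_integral (of_real x))) has_real_derivative
           (if x = 0 then 1 else - (ln (1 - x) / x))) (at x)"
proof -
  have "complex_of_real x \<notin> complex_of_real ` {1..}" using assms by (simp add: not_in_cut_iff)
  note dilog_integral_has_field_derivative[OF this]
  moreover have "(of_real has_vector_derivative 1) (at x)"
    by (auto intro!: derivative_eq_intros)
  ultimately have "(dilog_integral \<circ> of_real has_vector_derivative
      1 * (if complex_of_real x = 0 then 1 else - (Ln (1 - of_real x) / of_real x))) (at x)"
    by (intro field_vector_diff_chain_at)
  then have "((\<lambda>x. Re (dilog_integral (of_real x))) has_real_derivative
      Re (1 * (if complex_of_real x = 0 then 1 else - (Ln (1 - of_real x) / of_real x)))) (at x)"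
    unfolding o_def by (rule has_field_derivative_Re)
  also have "Re (1 * (if complex_of_real x = 0 then 1 else - (Ln (1 - of_real x) / of_real x)))
      = (if x = 0 then 1 else - (ln (1 - x) / x))"
    using assms Ln_of_real[of "1 - x"] by simp
  finally show ?thesis .
qed

text \<open>For nonzero \<open>t < 1\<close> the numbers \<open>ln (1 - t)\<close> and
  \<open>t\<close> have opposite signs.\<close>

lemma Re_dilog_integral_strict_mono:
  assumes "x < y" "y < 1"
  shows "Re (dilog_integral (of_real x)) < Re (dilog_integral (of_real y))"
proof (rule DERIV_pos_imp_increasing[OF assms(1), where f = "\<lambda>x. Re (dilog_integral (of_real x))"])
  fix t assume t: "x \<le> t" "t \<le> y"
  then have "t < 1" using assms by simp
  moreover have "0 < (if t = 0 then 1 else - (ln (1 - t) / t))"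
    using \<open>t < 1\<close> by (auto simp: divide_less_0_iff)
  ultimately show "\<exists>d. ((\<lambda>x. Re (dilog_integral (of_real x))) has_real_derivative d) (at t) \<and> 0 < d"
    using Re_dilog_integral_deriv by blast
qed

lemma Re_dilog_integral_le:
  assumes "x < 1"
  shows "Re (dilog_integral (of_real x)) \<le> pi\<^sup>2 / 6"
proof (cases "x < 0")
  case True
  then have "Re (dilog_integral (of_real x)) < 0"
    using Re_dilog_integral_strict_mono[of x 0] by simp
  also have "0 \<le> pi\<^sup>2 / 6" by simp
  finally show ?thesis by simp
next
  case False
  then have "Re (dilog_integral (of_real x)) = Re (dilog_sum (of_real x))"
    using assms by (subst dilog_integral_eq_dilog_sum) auto
  also have "\<dots> \<le> norm (dilog_sum (of_real x))" by (rule complex_Re_le_cmod)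
  also have "\<dots> \<le> pi\<^sup>2 / 6" using False assms by (intro norm_dilog_sum_le) auto
  finally show ?thesis .
qed

text \<open>Adding \<open>s\<^sup>2 / 2\<close> gives a function with derivative
  \<open>t - ln (1 + exp t)\<close>, which is negative, and with a negative value at
  \<open>0\<close>. The bound shows that arbitrarily negative values are attained.\<close>

lemma Re_dilog_integral_neg_exp_le:
  assumes "0 \<le> s"
  shows "Re (dilog_integral (of_real (- exp s))) \<le> - (s\<^sup>2 / 2)"
proof -
  define k where "k s = Re (dilog_integral (of_real (- exp s))) + s\<^sup>2 / 2" for s
  have k': "(k has_real_derivative (- ln (1 + exp t) + t)) (at t)" for t
  proof -
    have "((\<lambda>s. Re (dilog_integral (of_real (- exp s)))) has_real_derivative
        (if - exp t = 0 then 1 else - (ln (1 - (- exp t)) / (- exp t))) * (- exp t)) (at t)"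
    proof (rule DERIV_chain2[OF Re_dilog_integral_deriv])
      show "- exp t < 1" using exp_gt_zero[of t] by linarith
    qed (auto intro!: derivative_eq_intros)
    moreover have "((\<lambda>s. s\<^sup>2 / 2) has_real_derivative t) (at t)"
      by (auto intro!: derivative_eq_intros)
    ultimately show ?thesis
      unfolding k_def by (rule DERIV_cong[OF DERIV_add]) auto
  qed
  have "k s \<le> k 0"
  proof (rule DERIV_nonpos_imp_nonincreasing[OF assms, where f = k])
    fix t :: real
    have "ln (exp t) \<le> ln (1 + exp t)" by (subst ln_le_cancel_iff) (auto simp: add_pos_pos)
    then show "\<exists>y. (k has_real_derivative y) (at t) \<and> y \<le> 0" using k' by fastforce
  qed
  also have "k 0 < 0"
    using Re_dilog_integral_strict_mono[of "- 1" 0] by (simp add: k_def)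
  finally show ?thesis by (simp add: k_def)
qed

lemma \<phi>_zeros_0:
  "\<phi>_zeros A 0 = of_real ` {x. x < 1 \<and> Re (dilog_integral (of_real x)) = - 4 * pi\<^sup>2 * of_int A}"
proof (intro set_eqI iffI)
  fix z assume "z \<in> \<phi>_zeros A 0"
  then have zero: "\<phi> A 0 z = 0" by (simp add: \<phi>_zeros_def)
  have "Im z = 0"
  proof (rule ccontr)
    assume nr: "Im z \<noteq> 0"
    then have "Im (\<phi> A 0 z) = Im (dilog_integral z)"
      by (simp add: \<phi>_off_cut not_in_cut_iff flip: of_real_power)
    moreover have "Im (dilog_integral (cnj z)) = - Im (dilog_integral z)"
      using nr by (simp add: dilog_integral_cnj not_in_cut_iff)
    ultimately show False
      using nr zero Im_dilog_integral_pos[of z] Im_dilog_integral_pos[of "cnj z"]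
      by (cases "0 < Im z") auto
  qed
  then obtain x where x: "z = of_real x" by (metis complex_is_Real_iff Reals_cases)
  have "x < 1" using \<phi>_cut_nonzero[of x A 0] zero x by force
  moreover from this have "Re (dilog_integral (of_real x)) = - 4 * pi\<^sup>2 * of_int A"
    using zero by (simp add: x \<phi>_off_cut not_in_cut_iff complex_eq_iff flip: of_real_power)
  ultimately show "z \<in> of_real ` {x. x < 1 \<and> Re (dilog_integral (of_real x)) = - 4 * pi\<^sup>2 * of_int A}"
    using x by blast
next
  fix z assume "z \<in> complex_of_real ` {x. x < 1 \<and> Re (dilog_integral (of_real x)) = - 4 * pi\<^sup>2 * of_int A}"
  then obtain x where x: "z = of_real x" "x < 1" "Re (dilog_integral (of_real x)) = - 4 * pi\<^sup>2 * of_int A"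
    by auto
  have "dilog_integral (of_real x) = of_real (- 4 * pi\<^sup>2 * of_int A)"
    by (rule complex_eqI) (simp_all only: x Im_dilog_integral_of_real Re_complex_of_real Im_complex_of_real)
  with x(1,2) have "\<phi> A 0 z = 0" by (simp add: \<phi>_off_cut not_in_cut_iff)
  then show "z \<in> \<phi>_zeros A 0" by (simp add: \<phi>_zeros_def \<phi>_domain_def)
qed

lemma \<phi>_zeros_0_neg:
  assumes "A < 0"
  shows "\<phi>_zeros A 0 = {}"
proof -
  have "real_of_int A \<le> - 1" using assms by linarith
  then have "pi\<^sup>2 * of_int A \<le> pi\<^sup>2 * - 1" by (intro mult_left_mono) auto
  moreover have "0 < pi\<^sup>2" by simp
  ultimately have "pi\<^sup>2 / 6 < - 4 * pi\<^sup>2 * of_int A" by linarith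
  then show ?thesis using Re_dilog_integral_le by (fastforce simp: \<phi>_zeros_0)
qed

lemma \<phi>_zeros_0_nonneg:
  assumes "0 \<le> A"
  shows "\<exists>z. \<phi>_zeros A 0 = {z} \<and> simple_zero (\<phi> A 0) z"
proof -
  define h where "h x = Re (dilog_integral (of_real x))" for x
  \<comment> \<open>With \<open>s\<^sup>2 / 2 = 4 * pi\<^sup>2 * A\<close> the previous bound puts
    \<open>h (- exp s)\<close> below the target value, while \<open>h 0 = 0\<close> is above
    it.\<close>
  define s where "s = sqrt (8 * pi\<^sup>2 * of_int A)"
  have s: "0 \<le> s" "s\<^sup>2 / 2 = 4 * pi\<^sup>2 * of_int A" using assms by (auto simp: s_def)
  have "\<exists>x\<ge>- exp s. x \<le> 0 \<and> h x = - 4 * pi\<^sup>2 * of_int A"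
  proof (rule IVT')
    show "h (- exp s) \<le> - 4 * pi\<^sup>2 * of_int A"
      using Re_dilog_integral_neg_exp_le[OF s(1)] s(2) by (simp add: h_def)
    show "continuous_on {- exp s..0} h"
      unfolding h_def using DERIV_isCont[OF Re_dilog_integral_deriv]
      by (intro continuous_at_imp_continuous_on) auto
  qed (use assms in \<open>auto simp: h_def\<close>)
  then obtain x where x: "x \<le> 0" "h x = - 4 * pi\<^sup>2 * of_int A" by auto
  have "y = x" if "y < 1" "h y = h x" for y
    using that x Re_dilog_integral_strict_mono[of x y] Re_dilog_integral_strict_mono[of y x]
    by (cases x y rule: linorder_cases) (auto simp: h_def)
  with x have zeros: "\<phi>_zeros A 0 = {of_real x}"
    unfolding \<phi>_zeros_0 h_def[symmetric] by force
  then have zero: "\<phi> A 0 (of_real x) = 0" by (auto simp: \<phi>_zeros_def)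
  have "simple_zero (\<phi> A 0) (of_real x)"
  proof (cases "x = 0")
    case True
    then have "A = 0" using x by (simp add: h_def)
    with True show ?thesis using \<phi>_0_0_simple_zero by simp
  next
    case False
    with x zero show ?thesis by (intro \<phi>_simple_zero) (auto simp: not_in_cut_iff)
  qed
  with zeros show ?thesis by blast
qed

theorem theorem1p1:
  fixes A B :: int
  shows "(\<not> ((B = 0 \<and> A \<ge> 0) \<or>
             (- (real_of_int \<bar>B\<bar>) / 2 < real_of_int A \<and> real_of_int A \<le> real_of_int \<bar>B\<bar> / 2))
          \<longrightarrow> \<phi>_zeros A B = {})
       \<and> ((B = 0 \<and> A \<ge> 0) \<or>
          (- (real_of_int \<bar>B\<bar>) / 2 < real_of_int A \<and> real_of_int A \<le> real_of_int \<bar>B\<bar> / 2)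
          \<longrightarrow> (\<exists>z. \<phi>_zeros A B = {z} \<and> simple_zero (\<phi> A B) z))"
proof (cases "B = 0")
  case True
  then show ?thesis using \<phi>_zeros_0_neg[of A] \<phi>_zeros_0_nonneg[of A] by auto
next
  case False
  \<comment> \<open>The range of \<open>A\<close> splits by the sign of \<open>A\<close> into the
    conditions for \<open>B\<close> and \<open>- B\<close>. They exclude each other, so exactly one
    half-plane contains a zero.\<close>
  have cond: "(- (real_of_int \<bar>B\<bar>) / 2 < real_of_int A \<and> real_of_int A \<le> real_of_int \<bar>B\<bar> / 2)
      \<longleftrightarrow> upper_zero_cond A B \<or> upper_zero_cond A (- B)"
    and excl: "\<not> (upper_zero_cond A B \<and> upper_zero_cond A (- B))"
    using False unfolding upper_zero_cond_def by linarith+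
  have simple: "simple_zero (\<phi> A B) z" if "z \<in> \<phi>_zeros A B" for z
  proof -
    have z: "z \<noteq> 0" "\<phi> A B z = 0" using that False by (auto simp: \<phi>_zeros_def \<phi>_domain_def)
    with \<phi>_zero_not_real[OF False z] show ?thesis
      by (intro \<phi>_simple_zero) (auto simp: not_in_cut_iff complex_nonpos_Reals_iff)
  qed
  have "if upper_zero_cond A B \<or> upper_zero_cond A (- B) then \<exists>z. \<phi>_zeros A B = {z} else \<phi>_zeros A B = {}"
    using \<phi>_zeros_upper[of B A] \<phi>_zeros_upper[of "- B" A] False excl
    unfolding \<phi>_zeros_eq[OF False] by (auto split: if_splits)
  then show ?thesis using False simple unfolding cond by (auto split: if_splits)
qed

end
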